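(* Let $\Delta\geq 3$ and let $T$ be a tree with $n$ vertices, maximum degree $\Delta$ and second maximum degree $\Delta_{2}$. Then $$SO_{1}(T)\geq \frac{1}{2}\big[(\Delta-1)(\Delta^{2}-1)+(\Delta_{2}-1)(\Delta_{2}^{2}-1)+\Delta^{2}-\Delta_{2}^{2}\big],$$ with equality if and only if $T\in \mathcal{DST}_{n,\Delta,\Delta_{2}}$.
   Context: All graphs are finite and simple. For a graph $G$, $d_u$ is the degree of the vertex $u$, and $SO_{1}(G)=\frac{1}{2}\sum_{uv\in E(G)}|d_{u}^{2}-d_{v}^{2}|$. The second maximum degree $\Delta_2$ is the second term of the degree sequence arranged in nonincreasing order (counted with multiplicity). $\mathcal{DST}_{n,\Delta,\Delta_{2}}$ is the set of $n$-vertex graphs obtained from two starlike trees, with center degrees $\Delta-1$ and $\Delta_{2}-1$ respectively, by adding one edge between their centers. Here a starlike tree with center $c$ of degree $k\ge 0$ is a tree consisting of $c$ together with $k$ paths attached at $c$ that are pairwise disjoint apart from $c$ (for $k\geq 3$: a tree whose only vertex of degree at least $3$ is $c$, of degree $k$; for $k\le 2$: a path with a designated vertex $c$ of degree $k$). *)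

theory Defs
  imports Complex_Main "HOL-Library.Multiset"
begin

text \<open>A graph is a pair of a vertex set and a set of edges, each edge being a two-element set
  of vertices.\<close>

type_synonym 'a graph = "'a set \<times> 'a set set"

abbreviation verts :: "'a graph \<Rightarrow> 'a set" where
  "verts G \<equiv> fst G"

abbreviation edges :: "'a graph \<Rightarrow> 'a set set" where
  "edges G \<equiv> snd G"

definition simple_graph :: "'a graph \<Rightarrow> bool" where
  "simple_graph G \<longleftrightarrow> finite (verts G) \<and> (\<forall>e\<in>edges G. e \<subseteq> verts G \<and> card e = 2)"

definition degree :: "'a graph \<Rightarrow> 'a \<Rightarrow> nat" where
  "degree G u = card {v \<in> verts G. {u, v} \<in> edges G}"

definition degree_sequence :: "'a graph \<Rightarrow> nat list" where
  "degree_sequence G = rev (sorted_list_of_multiset (image_mset (degree G) (mset_set (verts G))))"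

definition max_degree :: "'a graph \<Rightarrow> nat" where
  "max_degree G = Max (degree G ` verts G)"

text \<open>Lists are indexed from \<open>0\<close>, so the second term has index \<open>1\<close>. This is meaningful only for
  graphs with at least two vertices.\<close>

definition second_max_degree :: "'a graph \<Rightarrow> nat" where
  "second_max_degree G = degree_sequence G ! 1"

text \<open>The sum ranges over ordered pairs of adjacent vertices, so it counts every edge twice;
  the inner factor \<open>1 / 2\<close> compensates for this, the outer one belongs to \<open>SO\<^sub>1\<close>.\<close>

definition SO1 :: "'a graph \<Rightarrow> real" where
  "SO1 G = 1 / 2 * (1 / 2 * (\<Sum>(u, v) \<in> {(u, v). u \<in> verts G \<and> v \<in> verts G \<and> {u, v} \<in> edges G}.
     \<bar>(real (degree G u))\<^sup>2 - (real (degree G v))\<^sup>2\<bar>))"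

definition path_edges :: "'a list \<Rightarrow> 'a set set" where
  "path_edges xs = {{xs ! i, xs ! Suc i} | i. Suc i < length xs}"

definition connected_graph :: "'a graph \<Rightarrow> bool" where
  "connected_graph G \<longleftrightarrow> verts G \<noteq> {} \<and>
     (\<forall>u\<in>verts G. \<forall>v\<in>verts G. (u, v) \<in> {(x, y). {x, y} \<in> edges G}\<^sup>*)"

definition is_cycle :: "'a graph \<Rightarrow> 'a list \<Rightarrow> bool" where
  "is_cycle G xs \<longleftrightarrow> length xs \<ge> 3 \<and> distinct xs \<and>
     path_edges xs \<subseteq> edges G \<and> {last xs, hd xs} \<in> edges G"

definition is_tree :: "'a graph \<Rightarrow> bool" where
  "is_tree G \<longleftrightarrow> simple_graph G \<and> connected_graph G \<and> (\<nexists>xs. is_cycle G xs)"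

text \<open>The list \<open>ps\<close> contains the \<open>k\<close> paths attached at \<open>c\<close>, each given by its vertices other than
  \<open>c\<close> in order of increasing distance from \<open>c\<close>. Being attached at \<open>c\<close> and disjoint apart from
  \<open>c\<close>, these paths always form a tree, in which \<open>c\<close> has degree \<open>k\<close>.\<close>

definition starlike_tree :: "'a graph \<Rightarrow> 'a \<Rightarrow> nat \<Rightarrow> bool" where
  "starlike_tree G c k \<longleftrightarrow>
     (\<exists>ps. length ps = k \<and> (\<forall>p\<in>set ps. p \<noteq> []) \<and> distinct (c # concat ps) \<and>
        verts G = set (c # concat ps) \<and>
        edges G = (\<Union>p\<in>set ps. path_edges (c # p)))"

text \<open>The conditions \<open>0 < D1\<close> and \<open>0 < D2\<close> keep the truncated subtractions meaningful.\<close>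

definition DST :: "nat \<Rightarrow> nat \<Rightarrow> nat \<Rightarrow> 'a graph set" where
  "DST n D1 D2 = {G. card (verts G) = n \<and> 0 < D1 \<and> 0 < D2 \<and>
     (\<exists>S1 S2 c1 c2. starlike_tree S1 c1 (D1 - 1) \<and> starlike_tree S2 c2 (D2 - 1) \<and>
        verts S1 \<inter> verts S2 = {} \<and>
        verts G = verts S1 \<union> verts S2 \<and>
        edges G = edges S1 \<union> edges S2 \<union> {{c1, c2}})}"

end

theory Submission
  imports Defs
begin

text \<open>Layer-cake decomposition: the sum of \<open>\<bar>d\<^sub>u\<^sup>2 - d\<^sub>v\<^sup>2\<bar>\<close> over the edges equals the sum over
  \<open>t \<ge> 2\<close> of \<open>2 t - 1\<close> times the number of edges leaving the level set \<open>H\<^sub>t = {u. d\<^sub>u \<ge> t}\<close>. A set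
  \<open>H\<close> of vertices of a tree spans at most \<open>card H - 1\<close> edges, so at least
  \<open>2 + (\<Sum>u\<in>H. d\<^sub>u - 2)\<close> edges leave it. For \<open>2 \<le> t \<le> \<Delta>\<^sub>2\<close> the level set contains the two top
  vertices and this is at least \<open>\<Delta> + \<Delta>\<^sub>2 - 2\<close>; for \<open>\<Delta>\<^sub>2 < t \<le> \<Delta>\<close> it is a single vertex and
  exactly \<open>\<Delta>\<close> edges leave it. Equality at all levels amounts to an edge joining vertices of degrees
  \<open>\<Delta>\<close> and \<open>\<Delta>\<^sub>2\<close> such that all other degrees are at most \<open>2\<close>; following the paths that leave
  these two vertices exhibits the tree as a double starlike tree.\<close>

section \<open>Arcs and degrees\<close>

text \<open>Edges are taken as ordered pairs, so that an edge inside \<open>A\<close> counts twice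
  in \<open>arcs G A A\<close>, as in the degree sum, while an edge between disjoint
  \<open>A\<close> and \<open>B\<close> counts once in \<open>arcs G A B\<close>.\<close>

definition arcs :: "'a graph \<Rightarrow> 'a set \<Rightarrow> 'a set \<Rightarrow> ('a \<times> 'a) set" where
  "arcs G A B = {(u, v). u \<in> A \<and> v \<in> B \<and> {u, v} \<in> edges G}"

lemma edge_in_verts:
  assumes "simple_graph G" "{u, v} \<in> edges G"
  shows "u \<in> verts G" "v \<in> verts G" "u \<noteq> v"
  using assms unfolding simple_graph_def by (fastforce simp: card_insert_if)+

lemma edge_commute: "{u, v} \<in> edges G \<longleftrightarrow> {v, u} \<in> edges G"
  by (simp add: insert_commute)

lemma finite_arcs: "finite A \<Longrightarrow> finite B \<Longrightarrow> finite (arcs G A B)"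
  by (rule finite_subset[of _ "A \<times> B"]) (auto simp: arcs_def)

lemma card_arcs_commute: "card (arcs G A B) = card (arcs G B A)"
proof -
  have "arcs G A B = prod.swap ` arcs G B A"
    by (auto simp: arcs_def image_def insert_commute)
  then show ?thesis by (simp add: card_image)
qed

lemma card_arcs_Un_right:
  assumes "finite A" "finite B" "finite C" "B \<inter> C = {}"
  shows "card (arcs G A (B \<union> C)) = card (arcs G A B) + card (arcs G A C)"
proof -
  have "arcs G A (B \<union> C) = arcs G A B \<union> arcs G A C" "arcs G A B \<inter> arcs G A C = {}"
    using assms(4) by (auto simp: arcs_def)
  then show ?thesis using assms by (simp add: card_Un_disjoint finite_arcs)
qed

lemma card_arcs_Un_left:
  assumes "finite A" "finite B" "finite C" "B \<inter> C = {}"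
  shows "card (arcs G (B \<union> C) A) = card (arcs G B A) + card (arcs G C A)"
  using card_arcs_Un_right[OF assms] by (simp add: card_arcs_commute)

lemma card_arcs_singleton: "card (arcs G {x} A) = card {v \<in> A. {x, v} \<in> edges G}"
proof -
  have "arcs G {x} A = Pair x ` {v \<in> A. {x, v} \<in> edges G}"
    by (auto simp: arcs_def)
  then show ?thesis by (simp add: card_image inj_on_def)
qed

lemma card_arcs_degree:
  assumes "finite (verts G)" "finite A"
  shows "card (arcs G A (verts G)) = (\<Sum>u\<in>A. degree G u)"
proof -
  have "arcs G A (verts G) = (SIGMA u:A. {v \<in> verts G. {u, v} \<in> edges G})"
    by (auto simp: arcs_def)
  then show ?thesis using assms by (simp add: degree_def)
qed

text \<open>There is no loop at \<open>x\<close>, so the new arcs are those from \<open>x\<close>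
  into \<open>A\<close> and their reversals.\<close>

lemma card_arcs_self_insert:
  assumes "simple_graph G" "finite A" "x \<notin> A"
  shows "card (arcs G (insert x A) (insert x A)) =
    card (arcs G A A) + 2 * card {v \<in> A. {x, v} \<in> edges G}"
proof -
  have "arcs G {x} {x} = {}"
    using edge_in_verts(3)[OF assms(1), of x x] by (auto simp: arcs_def)
  then have "card (arcs G ({x} \<union> A) ({x} \<union> A)) = card (arcs G A A) + 2 * card (arcs G {x} A)"
    using assms(2,3) card_arcs_Un_left[of "{x} \<union> A" "{x}" A G] card_arcs_commute[of G A "{x}"]
      card_arcs_Un_right[of "{x}" "{x}" A G] card_arcs_Un_right[of A "{x}" A G] by simp
  then show ?thesis by (simp add: card_arcs_singleton)
qed

lemma card_arcs_boundary:
  assumes "finite (verts G)" "A \<subseteq> verts G"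
  shows "card (arcs G A A) + card (arcs G A (verts G - A)) = (\<Sum>u\<in>A. degree G u)"
proof -
  have "finite A" using assms finite_subset by auto
  moreover have "A \<union> (verts G - A) = verts G" using assms(2) by blast
  ultimately show ?thesis
    using card_arcs_Un_right[of A A "verts G - A" G] card_arcs_degree[of G A] assms by simp
qed

lemma degree_eq_neighbours:
  assumes "simple_graph G"
  shows "degree G u = card {v. {u, v} \<in> edges G}"
  unfolding degree_def using edge_in_verts(2)[OF assms] by (metis (mono_tags, lifting))

lemma finite_neighbours:
  assumes "simple_graph G"
  shows "finite {v. {u, v} \<in> edges G}"
proof (rule finite_subset)
  show "{v. {u, v} \<in> edges G} \<subseteq> verts G" using edge_in_verts(2)[OF assms] by blast
  show "finite (verts G)" using assms by (simp add: simple_graph_def)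
qed

section \<open>Paths and edge counts in trees\<close>

lemma path_edges_subset_iff:
  "path_edges xs \<subseteq> F \<longleftrightarrow> (\<forall>i. Suc i < length xs \<longrightarrow> {xs ! i, xs ! Suc i} \<in> F)"
  unfolding path_edges_def by blast

lemma path_edges_image: "path_edges xs = (\<lambda>i. {xs ! i, xs ! Suc i}) ` {..<length xs - 1}"
  unfolding path_edges_def by auto

lemma path_edges_singleton: "path_edges [x] = {}"
  by (simp add: path_edges_def)

lemma path_edges_snoc:
  assumes "xs \<noteq> []"
  shows "path_edges (xs @ [y]) = insert {last xs, y} (path_edges xs)"
proof -
  have "{..<length xs} = insert (length xs - 1) {..<length xs - 1}"
    using assms lessThan_Suc[of "length xs - 1"] by simp
  then have "path_edges (xs @ [y]) = insert {xs ! (length xs - 1), y}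
      ((\<lambda>i. {(xs @ [y]) ! i, (xs @ [y]) ! Suc i}) ` {..<length xs - 1})"
    using assms by (simp add: path_edges_image nth_append)
  also have "(\<lambda>i. {(xs @ [y]) ! i, (xs @ [y]) ! Suc i}) ` {..<length xs - 1} = path_edges xs"
    unfolding path_edges_image by (rule image_cong) (auto simp: nth_append)
  finally show ?thesis using assms by (simp add: last_conv_nth)
qed

lemma path_edges_Cons:
  assumes "xs \<noteq> []"
  shows "path_edges (x # xs) = insert {x, hd xs} (path_edges xs)"
proof -
  have "{..<length xs} = insert 0 (Suc ` {..<length xs - 1})"
    using assms lessThan_Suc_eq_insert_0[of "length xs - 1"] by simp
  then show ?thesis using assms by (simp add: path_edges_image image_image hd_conv_nth)
qed

text \<open>At an end of the path one candidate is spurious: \<open>i - 1\<close> truncates to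
  \<open>i\<close> at index 0, and \<open>Suc i\<close> runs past the last index. Only an inclusion
  is claimed.\<close>

lemma path_edges_neighbour:
  assumes "distinct xs" "i < length xs" "{xs ! i, y} \<in> path_edges xs"
  shows "y \<in> {xs ! (i - 1), xs ! Suc i}"
proof -
  obtain j where j: "Suc j < length xs" "{xs ! i, y} = {xs ! j, xs ! Suc j}"
    using assms(3) by (auto simp: path_edges_def)
  then consider "xs ! i = xs ! j" "y = xs ! Suc j" | "xs ! i = xs ! Suc j" "y = xs ! j"
    by (auto simp: doubleton_eq_iff)
  then show ?thesis
    using assms(1,2) j(1) by cases (simp_all add: nth_eq_iff_index_eq)
qed

lemma path_edges_in_set: "e \<in> path_edges xs \<Longrightarrow> e \<subseteq> set xs"
  unfolding path_edges_def by (auto simp: Suc_lessD)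

text \<open>The part of the path from index \<open>j\<close> on is closed by the chord and would be
  a cycle if it had three or more vertices.\<close>

lemma acyclic_chord:
  assumes "\<nexists>ys. is_cycle G ys" "distinct xs" "path_edges xs \<subseteq> edges G"
    and "j < length xs" "{last xs, xs ! j} \<in> edges G"
  shows "length xs \<le> Suc (Suc j)"
proof (rule ccontr)
  assume "\<not> length xs \<le> Suc (Suc j)"
  moreover have "path_edges (drop j xs) \<subseteq> edges G"
    using assms(3,4) unfolding path_edges_subset_iff by simp
  ultimately have "is_cycle G (drop j xs)"
    using assms unfolding is_cycle_def by (simp add: hd_drop_conv_nth)
  then show False using assms(1) by blast
qed

lemma ex_longest_list:
  assumes "P xs" "finite A" "\<And>ys. P ys \<Longrightarrow> distinct ys \<and> set ys \<subseteq> A"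
  shows "\<exists>ys. P ys \<and> (\<forall>zs. P zs \<longrightarrow> length zs \<le> length ys)"
proof -
  have bound: "\<forall>ys. P ys \<longrightarrow> length ys < Suc (card A)"
    using assms by (metis card_mono distinct_card less_Suc_eq_le)
  show ?thesis by (rule ex_has_greatest_nat[OF assms(1) bound])
qed

text \<open>An end of a longest path in \<open>A\<close> works: by maximality its neighbours in
  \<open>A\<close> lie on the path, and by \<open>acyclic_chord\<close> only its predecessor can be
  one.\<close>

lemma ex_low_degree_vertex:
  assumes "simple_graph G" "\<nexists>ys. is_cycle G ys" "finite A" "A \<noteq> {}"
  shows "\<exists>x\<in>A. card {v \<in> A. {x, v} \<in> edges G} \<le> 1"
proof -
  obtain h where h: "h \<in> A" using assms by blast
  let ?P = "\<lambda>xs. xs \<noteq> [] \<and> distinct xs \<and> set xs \<subseteq> A \<and> path_edges xs \<subseteq> edges G"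
  have "?P [h]" using h by (simp add: path_edges_singleton)
  then have "\<exists>xs. ?P xs \<and> (\<forall>zs. ?P zs \<longrightarrow> length zs \<le> length xs)"
    by (rule ex_longest_list[where P = ?P and xs = "[h]" and A = A]) (use assms(3) in simp_all)
  then obtain xs where xs: "?P xs" and max: "\<And>zs. ?P zs \<Longrightarrow> length zs \<le> length xs"
    by blast
  \<comment> \<open>For a one-vertex path the index truncates to 0 and the left side is
    empty.\<close>
  have "{v \<in> A. {last xs, v} \<in> edges G} \<subseteq> {xs ! (length xs - 2)}"
  proof safe
    fix v assume v: "v \<in> A" "{last xs, v} \<in> edges G"
    have "v \<in> set xs"
    proof (rule ccontr)
      assume "v \<notin> set xs"
      then have "?P (xs @ [v])" using xs v by (simp add: path_edges_snoc)
      from max[OF this] show False by simp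
    qed
    then obtain j where j: "j < length xs" "v = xs ! j" by (auto simp: in_set_conv_nth)
    have "length xs \<le> Suc (Suc j)"
      using acyclic_chord[OF assms(2)] xs v j by blast
    moreover have "v \<noteq> last xs" using edge_in_verts(3)[OF assms(1) v(2)] by simp
    then have "j \<noteq> length xs - 1" using j xs by (auto simp: last_conv_nth)
    ultimately have "j = length xs - 2" using j by linarith
    then show "v = xs ! (length xs - 2)" using j by simp
  qed
  then have "card {v \<in> A. {last xs, v} \<in> edges G} \<le> 1"
    using card_mono[of "{xs ! (length xs - 2)}"] by simp
  moreover have "last xs \<in> A" using xs last_in_set[of xs] by blast
  ultimately show ?thesis by blast
qed

text \<open>Deleting a vertex with at most one neighbour in \<open>A\<close> removes at most two
  arcs, which drives an induction on \<open>card A\<close>. This is the usual bound of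
  \<open>card A - 1\<close> edges for a forest, doubled.\<close>

lemma acyclic_card_arcs_le:
  assumes "simple_graph G" "\<nexists>ys. is_cycle G ys" "finite A" "A \<noteq> {}"
  shows "card (arcs G A A) + 2 \<le> 2 * card A"
  using assms(3,4)
proof (induction "card A" arbitrary: A)
  case 0
  then show ?case by simp
next
  case (Suc k)
  obtain x where x: "x \<in> A" "card {v \<in> A. {x, v} \<in> edges G} \<le> 1"
    using ex_low_degree_vertex[OF assms(1,2) Suc.prems] by blast
  define B where "B = A - {x}"
  have B: "A = insert x B" "x \<notin> B" "finite B" "card B = k"
    using x Suc by (auto simp: B_def)
  have "{v \<in> A. {x, v} \<in> edges G} = {v \<in> B. {x, v} \<in> edges G}"
    using edge_in_verts(3)[OF assms(1), of x x] B by auto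
  then have eq: "card (arcs G A A) = card (arcs G B B) + 2 * card {v \<in> B. {x, v} \<in> edges G}"
    and le: "card {v \<in> B. {x, v} \<in> edges G} \<le> 1"
    using card_arcs_self_insert[OF assms(1) B(3,2)] B x by auto
  show ?case
  proof (cases "B = {}")
    case True
    then show ?thesis using eq B by (simp add: arcs_def)
  next
    case False
    then have "card (arcs G B B) + 2 \<le> 2 * card B"
      using Suc.hyps(1)[of B] B by simp
    then show ?thesis using eq le B by simp
  qed
qed

lemma connected_closed:
  assumes "connected_graph G" "x \<in> W" "x \<in> verts G"
    and "\<And>u v. u \<in> W \<Longrightarrow> {u, v} \<in> edges G \<Longrightarrow> v \<in> W"
  shows "verts G \<subseteq> W"
proof
  fix y assume "y \<in> verts G"
  then have "(x, y) \<in> {(x, y). {x, y} \<in> edges G}\<^sup>*"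
    using assms(1,3) by (auto simp: connected_graph_def)
  then show "y \<in> W"
    by (induction rule: rtrancl_induct) (use assms in auto)
qed

text \<open>A vertex set grown from a single vertex, always adding a vertex adjacent to it, gains at
  least two arcs per step until it contains all vertices.\<close>

lemma connected_card_arcs_ge:
  assumes "simple_graph G" "connected_graph G"
  shows "2 * card (verts G) \<le> card (arcs G (verts G) (verts G)) + 2"
proof -
  have fin: "finite (verts G)" using assms by (simp add: simple_graph_def)
  have "\<exists>A\<subseteq>verts G. card A = Suc k \<and> 2 * Suc k \<le> card (arcs G A A) + 2"
    if "Suc k \<le> card (verts G)" for k
    using that
  proof (induction k)
    case 0
    obtain x where "x \<in> verts G" using assms by (auto simp: connected_graph_def)
    then show ?case by (intro exI[of _ "{x}"]) simp
  next
    case (Suc k)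
    then obtain A where A: "A \<subseteq> verts G" "card A = Suc k" "2 * Suc k \<le> card (arcs G A A) + 2"
      by auto
    have finA: "finite A" using A fin finite_subset by blast
    obtain a where a: "a \<in> A" using A by fastforce
    have "\<not> verts G \<subseteq> A"
      using A Suc.prems finA card_mono[of A "verts G"] by auto
    \<comment> \<open>A nonempty set with no edge leaving it would contain all vertices by
      \<open>connected_closed\<close>.\<close>
    then obtain u v where uv: "u \<in> A" "{u, v} \<in> edges G" "v \<notin> A"
      using connected_closed[OF assms(2) a] A a by blast
    have "{u} \<subseteq> {w \<in> A. {v, w} \<in> edges G}"
      using uv edge_commute[of u v G] by auto
    then have "1 \<le> card {w \<in> A. {v, w} \<in> edges G}"
      using card_mono[of "{w \<in> A. {v, w} \<in> edges G}" "{u}"] finA by simp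
    then have "2 * Suc (Suc k) \<le> card (arcs G (insert v A) (insert v A)) + 2"
      using card_arcs_self_insert[OF assms(1) finA uv(3)] A by simp
    moreover have "insert v A \<subseteq> verts G"
      using edge_in_verts(2)[OF assms(1) uv(2)] A by simp
    ultimately show ?case using finA uv A by (intro exI[of _ "insert v A"]) simp
  qed
  moreover have pos: "Suc (card (verts G) - 1) = card (verts G)"
    using assms(2) fin by (simp add: connected_graph_def card_gt_0_iff)
  ultimately obtain A where A: "A \<subseteq> verts G" "card A = card (verts G)"
    "2 * card (verts G) \<le> card (arcs G A A) + 2"
    by (metis order_refl)
  then have "A = verts G" using fin card_subset_eq by blast
  then show ?thesis using A by simp
qed

text \<open>An isolated vertex would form a closed set on its own, which misses
  \<open>y\<close>.\<close>

lemma connected_degree_pos: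
  assumes "simple_graph G" "connected_graph G" "x \<in> verts G" "y \<in> verts G" "x \<noteq> y"
  shows "1 \<le> degree G x"
proof (rule ccontr)
  assume "\<not> 1 \<le> degree G x"
  then have "{v. {x, v} \<in> edges G} = {}"
    using degree_eq_neighbours[OF assms(1), of x] finite_neighbours[OF assms(1), of x]
    by (metis One_nat_def Suc_leI card_gt_0_iff)
  then have "verts G \<subseteq> {x}" using assms by (intro connected_closed[of G x]) auto
  then show False using assms by auto
qed

section \<open>The two largest degrees\<close>

text \<open>Removing \<open>a\<close> from the vertices removes one copy of the largest degree from
  the multiset, so the second term of the sequence is the largest degree among the remaining
  vertices, also in the case of a tie.\<close>

lemma top_two_degrees:
  assumes "finite (verts G)" "2 \<le> card (verts G)"
  obtains a b where "a \<in> verts G" "b \<in> verts G" "a \<noteq> b"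
    "degree G a = max_degree G" "degree G b = second_max_degree G"
    "second_max_degree G \<le> max_degree G"
    "\<And>x. x \<in> verts G \<Longrightarrow> x \<noteq> a \<Longrightarrow> degree G x \<le> second_max_degree G"
proof -
  let ?V = "verts G" and ?d = "degree G"
  have ms: "mset (degree_sequence G) = image_mset ?d (mset_set ?V)"
    by (simp add: degree_sequence_def)
  have len: "length (degree_sequence G) = card ?V"
    using arg_cong[OF ms, of size] by simp
  then obtain x y zs where seq: "degree_sequence G = x # y # zs"
    using assms(2) by (metis Suc_le_length_iff numeral_2_eq_2)
  have "sorted (rev (degree_sequence G))" by (simp add: degree_sequence_def)
  then have ord: "y \<le> x" "\<forall>z\<in>set zs. z \<le> y"
    unfolding seq by (auto simp: sorted_append)
  have "x \<in># image_mset ?d (mset_set ?V)" unfolding ms[symmetric] seq by simp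
  then obtain a where a: "a \<in> ?V" "?d a = x" using assms(1) by auto
  have V: "mset_set ?V = add_mset a (mset_set (?V - {a}))"
    using a assms(1) by (simp add: mset_set.remove)
  have rest: "add_mset y (mset zs) = image_mset ?d (mset_set (?V - {a}))"
    using ms a unfolding seq V by simp
  have "y \<in># image_mset ?d (mset_set (?V - {a}))" unfolding rest[symmetric] by simp
  then obtain b where b: "b \<in> ?V - {a}" "?d b = y" using assms(1) by auto
  have le: "?d v \<le> y" if "v \<in> ?V - {a}" for v
  proof -
    have "?d v \<in># image_mset ?d (mset_set (?V - {a}))" using that assms(1) by auto
    then show ?thesis unfolding rest[symmetric] using ord by auto
  qed
  have "second_max_degree G = y" by (simp add: second_max_degree_def seq)
  moreover have "max_degree G = x"
    unfolding max_degree_def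
  proof (rule Max_eqI)
    fix z assume "z \<in> ?d ` ?V"
    then obtain v where v: "v \<in> ?V" "z = ?d v" by auto
    then show "z \<le> x" using le[of v] a ord by (cases "v = a") auto
  qed (use assms a in auto)
  ultimately show ?thesis using that[of a b] a b le ord by auto
qed

section \<open>Level sets of the degree function\<close>

definition level :: "'a graph \<Rightarrow> nat \<Rightarrow> 'a set" where
  "level G t = {u \<in> verts G. t \<le> degree G u}"

definition degree_cut :: "'a graph \<Rightarrow> nat \<Rightarrow> nat" where
  "degree_cut G t = card (arcs G (level G t) (verts G - level G t))"

lemma level_subset: "level G t \<subseteq> verts G"
  by (auto simp: level_def)

lemma sum_odd: "(\<Sum>t\<in>{m<..n}. 2 * real t - 1) = (real n)\<^sup>2 - (real m)\<^sup>2" if "m \<le> n"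
  using that
proof (induction rule: dec_induct)
  case (step n)
  then have "{m<..Suc n} = insert (Suc n) {m<..n}" by auto
  then show ?case using step by (simp add: power2_eq_square algebra_simps)
qed simp

text \<open>Layer-cake form: \<open>2 t - 1\<close> is the increment of the squares from \<open>t - 1\<close> to \<open>t\<close>.\<close>

lemma SO1_eq_cuts:
  assumes "finite (verts G)" "\<And>u. u \<in> verts G \<Longrightarrow> 1 \<le> degree G u \<and> degree G u \<le> D"
  shows "SO1 G = 1 / 2 * (\<Sum>t\<in>{1<..D}. (2 * real t - 1) * real (degree_cut G t))"
proof -
  let ?V = "verts G" and ?d = "degree G"
  let ?A = "arcs G ?V ?V"
  \<comment> \<open>\<open>f u v t\<close> is the weight of level \<open>t\<close> on the arc from
    \<open>u\<close> to \<open>v\<close>, present only if the arc leads out of the level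
    set.\<close>
  define f where "f u v t = (if ?d v < t \<and> t \<le> ?d u then 2 * real t - 1 else 0)" for u v t
  have finA: "finite ?A" using assms(1) by (simp add: finite_arcs)
  have f: "(\<Sum>t\<in>{1<..D}. f u v t) = (if ?d v \<le> ?d u then (real (?d u))\<^sup>2 - (real (?d v))\<^sup>2 else 0)"
    if "u \<in> ?V" "v \<in> ?V" for u v
  proof -
    have "(\<Sum>t\<in>{1<..D}. f u v t) = (\<Sum>t\<in>{t \<in> {1<..D}. ?d v < t \<and> t \<le> ?d u}. 2 * real t - 1)"
      unfolding f_def by (rule sum.inter_filter[symmetric]) simp
    \<comment> \<open>All degrees lie between 1 and \<open>D\<close>, so the range of levels cuts
      nothing off.\<close>
    also have "{t \<in> {1<..D}. ?d v < t \<and> t \<le> ?d u} = {?d v<..?d u}"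
      using assms(2)[OF that(1)] assms(2)[OF that(2)] by auto
    finally show ?thesis by (simp add: sum_odd)
  qed
  have "(\<Sum>(u, v)\<in>?A. \<bar>(real (?d u))\<^sup>2 - (real (?d v))\<^sup>2\<bar>) =
      (\<Sum>(u, v)\<in>?A. (\<Sum>t\<in>{1<..D}. f u v t) + (\<Sum>t\<in>{1<..D}. f v u t))"
  proof (rule sum.cong[OF refl], clarify)
    fix u v assume "(u, v) \<in> ?A"
    then have uv: "u \<in> ?V" "v \<in> ?V" by (auto simp: arcs_def)
    have "(real (?d u))\<^sup>2 \<le> (real (?d v))\<^sup>2 \<longleftrightarrow> ?d u \<le> ?d v"
      by (simp add: power2_le_iff_abs_le)
    then show "\<bar>(real (?d u))\<^sup>2 - (real (?d v))\<^sup>2\<bar> = (\<Sum>t\<in>{1<..D}. f u v t) + (\<Sum>t\<in>{1<..D}. f v u t)"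
      unfolding f[OF uv] f[OF uv(2,1)] by auto
  qed
  also have "\<dots> = (\<Sum>(u, v)\<in>?A. \<Sum>t\<in>{1<..D}. f u v t) + (\<Sum>(u, v)\<in>?A. \<Sum>t\<in>{1<..D}. f v u t)"
    by (simp add: sum.distrib case_prod_beta)
  \<comment> \<open>Reversing all arcs exchanges the two sums; the resulting factor 2 cancels the
    inner \<open>1 / 2\<close> of \<open>SO1\<close>.\<close>
  also have "(\<Sum>(u, v)\<in>?A. \<Sum>t\<in>{1<..D}. f v u t) = (\<Sum>(u, v)\<in>?A. \<Sum>t\<in>{1<..D}. f u v t)"
    by (rule sum.reindex_bij_witness[of _ prod.swap prod.swap])
      (auto simp: arcs_def insert_commute)
  also have "(\<Sum>(u, v)\<in>?A. \<Sum>t\<in>{1<..D}. f u v t) = (\<Sum>t\<in>{1<..D}. \<Sum>(u, v)\<in>?A. f u v t)"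
    unfolding case_prod_beta by (rule sum.swap)
  also have "\<dots> = (\<Sum>t\<in>{1<..D}. (2 * real t - 1) * real (degree_cut G t))"
  proof (rule sum.cong[OF refl])
    fix t
    have "(\<Sum>(u, v)\<in>?A. f u v t) = (\<Sum>e\<in>?A. if ?d (snd e) < t \<and> t \<le> ?d (fst e) then 2 * real t - 1 else 0)"
      by (simp add: f_def case_prod_beta)
    also have "\<dots> = (\<Sum>e\<in>{e \<in> ?A. ?d (snd e) < t \<and> t \<le> ?d (fst e)}. 2 * real t - 1)"
      using finA by (rule sum.inter_filter[symmetric])
    also have "{e \<in> ?A. ?d (snd e) < t \<and> t \<le> ?d (fst e)} = arcs G (level G t) (?V - level G t)"
      by (auto simp: arcs_def level_def)
    finally show "(\<Sum>(u, v)\<in>?A. f u v t) = (2 * real t - 1) * real (degree_cut G t)"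
      by (simp add: degree_cut_def)
  qed
  finally show ?thesis by (simp add: SO1_def arcs_def)
qed


section \<open>Lower bounds for the cuts of a tree and when they are attained\<close>

lemma degree_cut_add:
  assumes "finite (verts G)"
  shows "card (arcs G (level G t) (level G t)) + degree_cut G t = (\<Sum>u\<in>level G t. degree G u)"
  using card_arcs_boundary[OF assms level_subset] by (simp add: degree_cut_def)

text \<open>The top vertices are parameters described by their degrees alone: with ties several
  pairs qualify, and the equality case needs an adjacent one.\<close>

locale two_top =
  fixes G :: "'a graph" and a b :: 'a
  assumes tree: "is_tree G"
    and a: "a \<in> verts G" and b: "b \<in> verts G" and neq: "a \<noteq> b"
    and deg_a: "3 \<le> degree G a"
    and deg_b: "degree G b \<le> degree G a"
    and deg_le: "\<And>x. x \<in> verts G \<Longrightarrow> x \<noteq> a \<Longrightarrow> degree G x \<le> degree G b"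
begin

lemma simple: "simple_graph G" and connected: "connected_graph G" and acyclic: "\<nexists>ys. is_cycle G ys"
  using tree by (auto simp: is_tree_def)

lemma fin: "finite (verts G)"
  using simple by (simp add: simple_graph_def)

lemma fin_level: "finite (level G t)"
  by (rule finite_subset[OF level_subset fin])

lemma degree_pos: "x \<in> verts G \<Longrightarrow> 1 \<le> degree G x"
  using connected_degree_pos[OF simple connected _ a] connected_degree_pos[OF simple connected _ b] neq
  by metis

text \<open>For \<open>2 \<le> t \<le> degree G a\<close> this is the cut in a tree where
  \<open>a\<close> and \<open>b\<close> are adjacent and all other degrees are at most 2: the common
  edge is lost at both ends, hence \<open>- 2\<close>, and above \<open>degree G b\<close> only
  \<open>a\<close> lies in the level set.\<close>

definition min_cut :: "nat \<Rightarrow> nat" where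
  "min_cut t = (if t \<le> degree G b then degree G a + degree G b - 2 else degree G a)"

text \<open>With \<open>p\<close> and \<open>q\<close> the degrees of \<open>a\<close> and
  \<open>b\<close>, the two ranges of levels telescope to \<open>(q^2 - 1) * (p + q - 2)\<close> and
  \<open>(p^2 - q^2) * p\<close>.\<close>

lemma sum_min_cut:
  "(\<Sum>t\<in>{1<..degree G a}. (2 * real t - 1) * real (min_cut t)) =
    (real (degree G a) - 1) * ((real (degree G a))\<^sup>2 - 1)
      + (real (degree G b) - 1) * ((real (degree G b))\<^sup>2 - 1)
      + (real (degree G a))\<^sup>2 - (real (degree G b))\<^sup>2"
proof -
  let ?p = "degree G a" and ?q = "degree G b"
  have q: "1 \<le> ?q" using degree_pos b by simp
  have "{1<..?p} = {1<..?q} \<union> {?q<..?p}" using q deg_b by auto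
  then have "(\<Sum>t\<in>{1<..?p}. (2 * real t - 1) * real (min_cut t)) =
      (\<Sum>t\<in>{1<..?q}. (2 * real t - 1) * real (min_cut t)) +
      (\<Sum>t\<in>{?q<..?p}. (2 * real t - 1) * real (min_cut t))"
    by (simp add: sum.union_disjoint)
  also have "(\<Sum>t\<in>{1<..?q}. (2 * real t - 1) * real (min_cut t)) =
      (\<Sum>t\<in>{1<..?q}. 2 * real t - 1) * (real ?p + real ?q - 2)"
    unfolding sum_distrib_right using deg_a by (intro sum.cong) (auto simp: min_cut_def)
  also have "(\<Sum>t\<in>{?q<..?p}. (2 * real t - 1) * real (min_cut t)) =
      (\<Sum>t\<in>{?q<..?p}. 2 * real t - 1) * real ?p"
    unfolding sum_distrib_right by (intro sum.cong) (auto simp: min_cut_def)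
  finally show ?thesis
    unfolding sum_odd[OF q] sum_odd[OF deg_b] by (simp add: power2_eq_square algebra_simps)
qed

lemma sum_level:
  assumes "2 \<le> t" "t \<le> degree G b"
  shows "(\<Sum>u\<in>level G t. degree G u) =
    degree G a + degree G b + (\<Sum>u\<in>level G t - {a, b}. degree G u)"
    and "card (level G t) = 2 + card (level G t - {a, b})"
proof -
  have ab: "a \<in> level G t" "b \<in> level G t - {a}"
    using assms a b neq deg_b by (auto simp: level_def)
  have eq: "level G t - {a} - {b} = level G t - {a, b}" by blast
  show "(\<Sum>u\<in>level G t. degree G u) =
      degree G a + degree G b + (\<Sum>u\<in>level G t - {a, b}. degree G u)"
    using sum.remove[OF fin_level ab(1), of "degree G"]
      sum.remove[OF _ ab(2), of "degree G"] fin_level eq by simp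
  show "card (level G t) = 2 + card (level G t - {a, b})"
    using card_Suc_Diff1[OF fin_level ab(1)] card_Suc_Diff1[OF _ ab(2)] fin_level eq by simp
qed

lemma level_others_ge:
  assumes "2 \<le> t"
  shows "2 * card (level G t - {a, b}) \<le> (\<Sum>u\<in>level G t - {a, b}. degree G u)"
  using sum_bounded_below[of "level G t - {a, b}" 2 "degree G"] assms
  by (auto simp: level_def mult.commute)

text \<open>The degree sum over the level set is the cut plus the inner arcs, which
  \<open>acyclic_card_arcs_le\<close> bounds. The degrees of the other vertices are kept, because
  the equality case compares them with 2.\<close>

lemma degree_cut_ge:
  assumes "2 \<le> t" "t \<le> degree G b"
  shows "degree G a + degree G b + (\<Sum>u\<in>level G t - {a, b}. degree G u)
    \<le> degree_cut G t + 2 + 2 * card (level G t - {a, b})"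
proof -
  have "b \<in> level G t" using assms b by (simp add: level_def)
  then have "level G t \<noteq> {}" by blast
  from acyclic_card_arcs_le[OF simple acyclic fin_level this] show ?thesis
    using degree_cut_add[OF fin, of t] sum_level[OF assms] by linarith
qed

lemma degree_cut_high:
  assumes "degree G b < t" "t \<le> degree G a"
  shows "degree_cut G t = degree G a"
proof -
  have lev: "level G t = {a}" using assms a deg_le by (force simp: level_def)
  have "arcs G {a} {a} = {}"
    using edge_in_verts(3)[OF simple, of a a] by (auto simp: arcs_def)
  then show ?thesis using degree_cut_add[OF fin, of t] lev by simp
qed

lemma min_cut_le:
  assumes "t \<in> {1<..degree G a}"
  shows "min_cut t \<le> degree_cut G t"
proof (cases "t \<le> degree G b")
  case True
  then show ?thesis
    using assms degree_cut_ge[of t] level_others_ge[of t] by (simp add: min_cut_def)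
next
  case False
  then show ?thesis using assms degree_cut_high[of t] by (simp add: min_cut_def)
qed

lemma SO1_cuts: "SO1 G = 1 / 2 * (\<Sum>t\<in>{1<..degree G a}. (2 * real t - 1) * real (degree_cut G t))"
proof (rule SO1_eq_cuts[OF fin])
  show "1 \<le> degree G u \<and> degree G u \<le> degree G a" if "u \<in> verts G" for u
    using degree_pos[OF that] deg_le[OF that] deg_b by (cases "u = a") auto
qed

lemma SO1_ge: "1 / 2 * (\<Sum>t\<in>{1<..degree G a}. (2 * real t - 1) * real (min_cut t)) \<le> SO1 G"
  unfolding SO1_cuts using min_cut_le by (intro mult_left_mono sum_mono) auto

text \<open>Every weight \<open>2 * t - 1\<close> is positive here and every cut is at least
  \<open>min_cut t\<close>, so the sums agree only if they agree termwise.\<close>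

lemma SO1_eq_iff:
  "SO1 G = 1 / 2 * (\<Sum>t\<in>{1<..degree G a}. (2 * real t - 1) * real (min_cut t)) \<longleftrightarrow>
    (\<forall>t\<in>{1<..degree G a}. degree_cut G t = min_cut t)"
proof
  assume "SO1 G = 1 / 2 * (\<Sum>t\<in>{1<..degree G a}. (2 * real t - 1) * real (min_cut t))"
  then have "(\<Sum>t\<in>{1<..degree G a}. (2 * real t - 1) * (real (degree_cut G t) - real (min_cut t))) = 0"
    unfolding SO1_cuts by (simp add: right_diff_distrib sum_subtractf)
  then have "\<forall>t\<in>{1<..degree G a}. (2 * real t - 1) * (real (degree_cut G t) - real (min_cut t)) = 0"
    by (subst (asm) sum_nonneg_eq_0_iff) (use min_cut_le in auto)
  then show "\<forall>t\<in>{1<..degree G a}. degree_cut G t = min_cut t" by fastforce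
next
  assume "\<forall>t\<in>{1<..degree G a}. degree_cut G t = min_cut t"
  then have "(\<Sum>t\<in>{1<..degree G a}. (2 * real t - 1) * real (degree_cut G t)) =
      (\<Sum>t\<in>{1<..degree G a}. (2 * real t - 1) * real (min_cut t))"
    by (intro sum.cong) simp_all
  then show "SO1 G = 1 / 2 * (\<Sum>t\<in>{1<..degree G a}. (2 * real t - 1) * real (min_cut t))"
    unfolding SO1_cuts by (rule arg_cong)
qed

text \<open>The cut at level \<open>2\<close> forces all other degrees to be at most \<open>2\<close>, and then the cut at
  level \<open>3\<close> forces an edge between the two top vertices.\<close>

lemma extremal_imp_adjacent:
  assumes "\<forall>t\<in>{1<..degree G a}. degree_cut G t = min_cut t"
  obtains v where "{a, v} \<in> edges G" "degree G v = degree G b"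
    "\<And>x. x \<in> verts G \<Longrightarrow> x \<noteq> a \<Longrightarrow> x \<noteq> v \<Longrightarrow> degree G x \<le> 2"
proof (cases "3 \<le> degree G b")
  case True
  have small: "degree G x \<le> 2" if x: "x \<in> verts G" "x \<noteq> a" "x \<noteq> b" for x
  proof (rule ccontr)
    let ?H = "level G 2 - {a, b}"
    assume "\<not> degree G x \<le> 2"
    moreover from this have "x \<in> ?H" using x by (auto simp: level_def)
    \<comment> \<open>The term of \<open>x\<close> exceeds 2, so the cut at level 2 would be larger
      than \<open>min_cut 2\<close>.\<close>
    ultimately have "(\<Sum>u\<in>?H. 2) < (\<Sum>u\<in>?H. degree G u)"
      using fin_level[of 2] by (intro sum_strict_mono_ex1) (auto simp: level_def not_le)
    then show False
      using degree_cut_ge[of 2] True assms deg_a by (simp add: min_cut_def)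
  qed
  have "level G 3 = {a, b}"
    using True a b deg_a small by (fastforce simp: level_def)
  then have "card (arcs G {a, b} {a, b}) + degree_cut G 3 = degree G a + degree G b"
    using degree_cut_add[OF fin, of 3] neq by simp
  \<comment> \<open>The cut at level 3 falls short of the degree sum by 2, so some arcs stay inside
    \<open>{a, b}\<close>.\<close>
  then have "arcs G {a, b} {a, b} \<noteq> {}"
    using True assms deg_a by (auto simp: min_cut_def)
  then have "{a, b} \<in> edges G"
    using edge_in_verts(3)[OF simple] by (auto simp: arcs_def insert_commute)
  then show ?thesis using that small by blast
next
  case False
  then have small: "degree G x \<le> 2" if "x \<in> verts G" "x \<noteq> a" for x
    using deg_le[OF that] by simp
  \<comment> \<open>Here \<open>b\<close> may be far from \<open>a\<close>, and a neighbour of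
    \<open>a\<close> with the same degree takes its place. If there were none, all neighbours of
    \<open>a\<close> would be leaves, so the tree would be a star around \<open>a\<close> and
    \<open>b\<close> itself such a neighbour.\<close>
  have "\<exists>v. {a, v} \<in> edges G \<and> degree G v = degree G b"
  proof (rule ccontr)
    assume none: "\<not> ?thesis"
    let ?W = "insert a {v. {a, v} \<in> edges G}"
    have "y = a" if "{a, x} \<in> edges G" "{x, y} \<in> edges G" for x y
    proof -
      have x: "x \<in> verts G" "x \<noteq> a" using edge_in_verts[OF simple that(1)] by auto
      then have "card {v. {x, v} \<in> edges G} \<le> 1"
        using deg_le[OF x] none that(1) False degree_eq_neighbours[OF simple, of x] by force
      then show ?thesis
        using that edge_commute[of a x G] finite_neighbours[OF simple, of x]
        by (metis (mono_tags, lifting) card_le_Suc0_iff_eq One_nat_def mem_Collect_eq)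
    qed
    then have "verts G \<subseteq> ?W"
      using a by (intro connected_closed[OF connected, of a]) auto
    then show False using b neq none by auto
  qed
  then show ?thesis using that small by blast
qed

text \<open>At level 2 the cut is at most the number of leaves, which the edge count of a connected
  graph bounds. At the higher levels up to \<open>degree G b\<close> the level set is
  \<open>{a, b}\<close>, and the common edge takes 2 off the degree sum.\<close>

lemma adjacent_imp_extremal:
  assumes edge: "{a, b} \<in> edges G"
    and small: "\<And>x. x \<in> verts G \<Longrightarrow> x \<noteq> a \<Longrightarrow> x \<noteq> b \<Longrightarrow> degree G x \<le> 2"
    and t: "t \<in> {1<..degree G a}"
  shows "degree_cut G t = min_cut t"
proof (cases "t \<le> degree G b")
  case False
  then show ?thesis using t degree_cut_high[of t] by (simp add: min_cut_def)
next
  case True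
  have "degree_cut G t + 2 \<le> degree G a + degree G b"
  proof (cases "t = 2")
    case t2: True
    let ?H = "level G 2" and ?L = "verts G - level G 2"
    have L: "degree G u = 1" if "u \<in> ?L" for u
      using degree_pos[of u] that by (auto simp: level_def)
    have "degree_cut G 2 \<le> card (arcs G (verts G) ?L)"
      unfolding degree_cut_def using fin level_subset[of G 2]
      by (intro card_mono finite_arcs) (auto simp: arcs_def)
    also have "\<dots> = (\<Sum>u\<in>?L. degree G u)"
      using card_arcs_degree[OF fin, of ?L] fin by (simp add: card_arcs_commute[of G "verts G"])
    also have "\<dots> = card ?L" using L by simp
    finally have cut: "degree_cut G 2 \<le> card ?L" .
    have "card (verts G) = card ?H + card ?L"
      using fin level_subset[of G 2] by (simp add: card_Diff_subset fin_level card_mono)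
    moreover have "card (arcs G (verts G) (verts G)) = (\<Sum>u\<in>?H. degree G u) + card ?L"
      using card_arcs_degree[OF fin fin] sum.subset_diff[OF level_subset[of G 2] fin, of "degree G"] L
      by simp
    moreover have "(\<Sum>u\<in>?H - {a, b}. degree G u) = 2 * card (?H - {a, b})"
    proof -
      have "degree G u = 2" if "u \<in> ?H - {a, b}" for u
        using that small[of u] by (auto simp: level_def)
      then show ?thesis by simp
    qed
    \<comment> \<open>In \<open>connected_card_arcs_ge\<close> the vertices of degree 2 outside
      \<open>{a, b}\<close> cancel and each leaf falls short by 1, so the degrees of
      \<open>a\<close> and \<open>b\<close> limit the number of leaves.\<close>
    ultimately have "card ?L + 2 \<le> degree G a + degree G b"
      using connected_card_arcs_ge[OF simple connected] sum_level[of 2] True t2 by simp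
    then show ?thesis using cut t2 by simp
  next
    case False
    then have "level G t = {a, b}"
      using t True a b small by (fastforce simp: level_def)
    moreover have "card {(a, b), (b, a)} \<le> card (arcs G {a, b} {a, b})"
      using edge by (intro card_mono finite_arcs) (auto simp: arcs_def insert_commute)
    ultimately show ?thesis using degree_cut_add[OF fin, of t] neq by simp
  qed
  then show ?thesis using min_cut_le[OF t] True by (simp add: min_cut_def)
qed

end


section \<open>Decomposition into arms\<close>

locale double_star = two_top +
  assumes edge: "{a, b} \<in> edges G"
    and small: "\<And>x. x \<in> verts G \<Longrightarrow> x \<noteq> a \<Longrightarrow> x \<noteq> b \<Longrightarrow> degree G x \<le> 2"
begin

text \<open>\<open>p\<close> omits the centre \<open>c\<close>, as in \<open>starlike_tree\<close>.
  The last conjunct makes the path complete: no edge at its vertices lies off it, so it neither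
  branches nor stops before a leaf.\<close>

definition arm :: "'a \<Rightarrow> 'a list \<Rightarrow> bool" where
  "arm c p \<longleftrightarrow> p \<noteq> [] \<and> distinct p \<and> set p \<subseteq> verts G - {a, b} \<and> path_edges (c # p) \<subseteq> edges G \<and>
    (\<forall>x\<in>set p. \<forall>y. {x, y} \<in> edges G \<longrightarrow> {x, y} \<in> path_edges (c # p))"

text \<open>A longest path that starts with \<open>c\<close>, \<open>v\<close> and avoids both
  centres after \<open>c\<close> is complete: an inner vertex has its two neighbours on the path,
  and a further neighbour of the last vertex would prolong the path or close a cycle.\<close>

lemma ex_arm:
  assumes c: "c \<in> {a, b}" and v: "{c, v} \<in> edges G" "v \<notin> {a, b}"
  shows "\<exists>p. arm c p \<and> hd p = v"
proof -
  let ?P = "\<lambda>p. p \<noteq> [] \<and> hd p = v \<and> distinct p \<and> set p \<subseteq> verts G - {a, b} \<and>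
    path_edges (c # p) \<subseteq> edges G"
  have "?P [v]"
    using v edge_in_verts(2)[OF simple v(1)] by (simp add: path_edges_Cons path_edges_singleton)
  then have "\<exists>p. ?P p \<and> (\<forall>q. ?P q \<longrightarrow> length q \<le> length p)"
    by (rule ex_longest_list[where P = ?P and xs = "[v]" and A = "verts G"]) (use fin in auto)
  then obtain p where p: "?P p" and max: "\<And>q. ?P q \<Longrightarrow> length q \<le> length p"
    by blast
  \<comment> \<open>With the centre in front every vertex of \<open>p\<close> has a predecessor;
    index \<open>i\<close> in \<open>p\<close> is \<open>Suc i\<close> in \<open>q\<close>.\<close>
  define q where "q = c # p"
  have q: "distinct q" "path_edges q \<subseteq> edges G" and q_ne: "q \<noteq> []"
    using p c by (auto simp: q_def)
  have "{x, y} \<in> path_edges q" if x: "x \<in> set p" and y: "{x, y} \<in> edges G" for x y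
  proof -
    obtain i where i: "i < length p" "x = q ! Suc i"
      using x by (auto simp: in_set_conv_nth q_def)
    have before: "{q ! i, x} \<in> path_edges q"
      using i by (auto simp: path_edges_def q_def)
    show ?thesis
    proof (cases "Suc i < length p")
      case True
      then have after: "{x, q ! Suc (Suc i)} \<in> path_edges q"
        unfolding path_edges_def mem_Collect_eq using i by (intro exI[of _ "Suc i"]) (simp add: q_def)
      have "q ! i \<noteq> q ! Suc (Suc i)"
        using q(1) i True nth_eq_iff_index_eq[of q i "Suc (Suc i)"] by (simp add: q_def)
      then have card: "card {q ! i, q ! Suc (Suc i)} = 2" by simp
      have "{q ! i, q ! Suc (Suc i)} \<subseteq> {y. {x, y} \<in> edges G}"
        using before after q(2) by (auto simp: insert_commute)
      moreover have "card {y. {x, y} \<in> edges G} \<le> 2"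
        using small[of x] x p degree_eq_neighbours[OF simple, of x] by auto
      ultimately have "{q ! i, q ! Suc (Suc i)} = {y. {x, y} \<in> edges G}"
        using card finite_neighbours[OF simple] by (intro card_seteq) auto
      then have "y = q ! i \<or> y = q ! Suc (Suc i)" using y by blast
      then show ?thesis using before after by (auto simp: insert_commute)
    next
      case False
      then have len: "length p = Suc i" using i by simp
      then have last: "last q = x" using i p by (simp add: q_def last_conv_nth)
      have "y \<in> set q"
      proof (rule ccontr)
        assume nq: "y \<notin> set q"
        show False
        proof (cases "y \<in> {a, b}")
          case True
          \<comment> \<open>\<open>y\<close> is the other centre, so the edge between the centres
            and the edge from \<open>x\<close> to \<open>y\<close> close \<open>q\<close> to a
            cycle.\<close>
          then have "{y, c} \<in> edges G"
            using c nq edge by (auto simp: q_def insert_commute)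
          then have "path_edges (y # q) \<subseteq> edges G"
            using q(2) by (simp add: path_edges_Cons q_def)
          then have "length (y # q) \<le> Suc (Suc 0)"
            using acyclic_chord[OF acyclic, of "y # q" 0] q(1) nq edge_commute[of x y G] y last q_ne
            by simp
          then show False using len by (simp add: q_def)
        next
          case False
          have "path_edges (c # p @ [y]) \<subseteq> edges G"
            using path_edges_snoc[of q y] q(2) y last by (simp add: q_def)
          then have "?P (p @ [y])"
            using p False nq edge_in_verts(2)[OF simple y] by (simp add: q_def)
          from max[OF this] show False by simp
        qed
      qed
      then obtain j where j: "j < length q" "y = q ! j" by (auto simp: in_set_conv_nth)
      have "length q \<le> Suc (Suc j)"
        using acyclic_chord[OF acyclic q j(1)] y last j by simp
      moreover have "j \<noteq> Suc i" using edge_in_verts(3)[OF simple y] i j by auto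
      ultimately have "j = i" using j len by (simp add: q_def)
      then show ?thesis using before j by (simp add: insert_commute)
    qed
  qed
  then have "arm c p" using p unfolding arm_def q_def by blast
  then show ?thesis using p by blast
qed

text \<open>The only edge leaving the vertex set of an arm is the one at its centre, so an arm that meets
  another one contains the head of the other.\<close>

lemma arm_disjoint:
  assumes "arm c p" "arm d q" "c \<in> {a, b}" "d \<in> {a, b}" "set p \<inter> set q \<noteq> {}"
  shows "c = d \<and> hd p = hd q"
proof -
  have p: "p \<noteq> []" "set p \<inter> {a, b} = {}" using assms(1) by (auto simp: arm_def)
  have q: "q \<noteq> []" "set q \<inter> {a, b} = {}" using assms(2) by (auto simp: arm_def)
  have closed: "{x, y} \<in> path_edges (c # p)" if "x \<in> set p" "{x, y} \<in> edges G" for x y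
    using that assms(1) by (simp add: arm_def)
  have edges_q: "{(d # q) ! i, (d # q) ! Suc i} \<in> edges G" if "i < length q" for i
    using assms(2) that unfolding arm_def path_edges_subset_iff by simp
  \<comment> \<open>Walking back along \<open>q\<close> never leaves \<open>p\<close>: the next
    vertex lies on \<open>c # p\<close> by completeness and is not a centre.\<close>
  have "q ! 0 \<in> set p" if "q ! i \<in> set p" "i < length q" for i
    using that
  proof (induction i)
    case (Suc i)
    have "{q ! Suc i, q ! i} \<in> edges G"
      using edges_q[of "Suc i"] Suc.prems by (simp add: insert_commute)
    then have "q ! i \<in> set (c # p)"
      using closed Suc.prems path_edges_in_set by blast
    moreover have "q ! i \<notin> {a, b}" using q Suc.prems nth_mem[of i q] by auto
    ultimately have "q ! i \<in> set p" using assms(3) by auto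
    then show ?case using Suc by simp
  qed simp
  then have hd: "hd q \<in> set p"
    using assms(5) q by (auto simp: in_set_conv_nth[of _ q] hd_conv_nth)
  have "{hd q, d} \<in> edges G"
    using edges_q[of 0] q by (simp add: insert_commute hd_conv_nth)
  then have "{hd q, d} \<in> insert {c, hd p} (path_edges p)"
    using closed[OF hd] p by (simp add: path_edges_Cons)
  \<comment> \<open>No edge within \<open>p\<close> touches a centre, so this edge must be the first
    one of \<open>c # p\<close>.\<close>
  moreover have "{hd q, d} \<notin> path_edges p"
    using path_edges_in_set[of "{hd q, d}" p] p assms(4) by auto
  ultimately have "{hd q, d} = {c, hd p}" by simp
  moreover have "hd q \<noteq> c" using hd p assms(3) by auto
  ultimately show ?thesis by (auto simp: doubleton_eq_iff)
qed

text \<open>One arm is chosen for each neighbour of \<open>c\<close> other than \<open>d\<close>,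
  which accounts for the \<open>- 1\<close>; arms with different heads are disjoint by
  \<open>arm_disjoint\<close>. The hypothesis lets \<open>c\<close> be either top vertex.\<close>

lemma ex_arms:
  assumes "{c, d} = {a, b}"
  obtains ps where "length ps = degree G c - 1" "distinct (c # concat ps)"
    "\<And>p. p \<in> set ps \<Longrightarrow> arm c p"
    "\<And>v. {c, v} \<in> edges G \<Longrightarrow> v \<noteq> d \<Longrightarrow> v \<in> set (concat ps)"
proof -
  have c: "c \<in> {a, b}" and d: "d \<in> {a, b}" "{c, d} \<in> edges G"
    and cd: "{a, b} = {c, d}" "c \<noteq> d"
    using assms edge neq by auto
  let ?N = "{v. {c, v} \<in> edges G} - {d}"
  have N: "v \<notin> {a, b}" if "v \<in> ?N" for v
    using that edge_in_verts(3)[OF simple, of c v] unfolding cd by auto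
  obtain vs where vs: "set vs = ?N" "distinct vs"
    using finite_distinct_list[of ?N] finite_neighbours[OF simple, of c] by blast
  have "\<forall>v\<in>?N. \<exists>p. arm c p \<and> hd p = v" using ex_arm[OF c] N by blast
  then obtain f where f: "\<And>v. v \<in> ?N \<Longrightarrow> arm c (f v)" "\<And>v. v \<in> ?N \<Longrightarrow> hd (f v) = v"
    by metis
  let ?ps = "map f vs"
  have "distinct (concat ?ps)"
  proof (rule distinct_concat)
    show "distinct ?ps"
      using vs f(2) by (auto simp: distinct_map inj_on_def) metis
    show "distinct p" if "p \<in> set ?ps" for p
      using that vs f(1) by (auto simp: arm_def)
    show "set p \<inter> set q = {}" if "p \<in> set ?ps" "q \<in> set ?ps" "p \<noteq> q" for p q
    proof (rule ccontr)
      obtain v w where "v \<in> set vs" "w \<in> set vs" and fvw: "p = f v" "q = f w"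
        using \<open>p \<in> set ?ps\<close> \<open>q \<in> set ?ps\<close> by auto
      then have vw: "v \<in> ?N" "w \<in> ?N" unfolding vs(1) by blast+
      assume "set p \<inter> set q \<noteq> {}"
      then have "hd p = hd q" using arm_disjoint[of c p c q] vw f(1) c fvw by blast
      then show False using vw fvw f(2) that(3) by metis
    qed
  qed
  moreover have "c \<notin> set (concat ?ps)" using vs f(1) c by (fastforce simp: arm_def)
  ultimately have "distinct (c # concat ?ps)" by simp
  moreover have "length ?ps = degree G c - 1"
    using vs d distinct_card[OF vs(2)] finite_neighbours[OF simple, of c]
    by (simp add: degree_eq_neighbours[OF simple] card_Diff_singleton)
  moreover have "arm c p" if "p \<in> set ?ps" for p using that vs f(1) by auto
  moreover have "v \<in> set (concat ?ps)" if "{c, v} \<in> edges G" "v \<noteq> d" for v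
  proof -
    have "v \<in> ?N" using that by simp
    moreover from this have "v \<in> set (f v)"
      using f[of v] hd_in_set[of "f v"] by (simp add: arm_def)
    ultimately show ?thesis using vs(1) by auto
  qed
  ultimately show ?thesis using that[of ?ps] by blast
qed

text \<open>The arms at \<open>a\<close> and at \<open>b\<close> form the two starlike trees.
  Together their vertices are closed under adjacency, hence exhaust the tree; an edge other than
  \<open>{a, b}\<close> has an end inside an arm and so belongs to it by completeness.\<close>

lemma in_DST: "G \<in> DST (card (verts G)) (degree G a) (degree G b)"
proof -
  obtain ps where ps: "length ps = degree G a - 1" "distinct (a # concat ps)"
    "\<And>p. p \<in> set ps \<Longrightarrow> arm a p"
    "\<And>v. {a, v} \<in> edges G \<Longrightarrow> v \<noteq> b \<Longrightarrow> v \<in> set (concat ps)"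
    using ex_arms[of a b] by blast
  obtain qs where qs: "length qs = degree G b - 1" "distinct (b # concat qs)"
    "\<And>p. p \<in> set qs \<Longrightarrow> arm b p"
    "\<And>v. {b, v} \<in> edges G \<Longrightarrow> v \<noteq> a \<Longrightarrow> v \<in> set (concat qs)"
    using ex_arms[of b a] by blast
  define A where "A = (set (a # concat ps), \<Union>p\<in>set ps. path_edges (a # p))"
  define B where "B = (set (b # concat qs), \<Union>p\<in>set qs. path_edges (b # p))"
  have star: "starlike_tree A a (degree G a - 1)" "starlike_tree B b (degree G b - 1)"
    unfolding starlike_tree_def A_def B_def using ps qs by (fastforce simp: arm_def)+
  have disjoint: "verts A \<inter> verts B = {}"
  proof -
    have "set p \<inter> set q = {}" if "p \<in> set ps" "q \<in> set qs" for p q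
      using arm_disjoint[OF ps(3)[OF that(1)] qs(3)[OF that(2)]] neq by blast
    moreover have "set p \<inter> {a, b} = {}" if "p \<in> set ps \<union> set qs" for p
    proof -
      have "arm a p \<or> arm b p" using that ps(3) qs(3) by blast
      then show ?thesis by (auto simp: arm_def)
    qed
    ultimately show ?thesis using neq unfolding A_def B_def by fastforce
  qed
  have leaving: "y \<in> set (c # p)" "{x, y} \<in> path_edges (c # p)"
    if "arm c p" "x \<in> set p" "{x, y} \<in> edges G" for c p x y
    using that path_edges_in_set[of "{x, y}" "c # p"] by (auto simp: arm_def)
  have "verts G \<subseteq> verts A \<union> verts B"
  proof (rule connected_closed[OF connected _ a])
    show "a \<in> verts A \<union> verts B" by (simp add: A_def)
    fix x y assume "x \<in> verts A \<union> verts B" and xy: "{x, y} \<in> edges G"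
    then consider "x = a" | "x = b" | p where "p \<in> set ps" "x \<in> set p" | q where "q \<in> set qs" "x \<in> set q"
      by (auto simp: A_def B_def)
    then show "y \<in> verts A \<union> verts B"
    proof cases
      case 1
      then show ?thesis using ps(4)[of y] xy by (auto simp: A_def B_def)
    next
      case 2
      then show ?thesis using qs(4)[of y] xy by (auto simp: A_def B_def)
    next
      case 3
      then show ?thesis using leaving(1)[OF ps(3) _ xy] by (auto simp: A_def)
    next
      case 4
      then show ?thesis using leaving(1)[OF qs(3) _ xy] by (auto simp: B_def)
    qed
  qed
  moreover have "verts A \<union> verts B \<subseteq> verts G"
    using ps(3) qs(3) a b by (fastforce simp: A_def B_def arm_def)
  ultimately have verts: "verts G = verts A \<union> verts B" by blast
  have "edges G = edges A \<union> edges B \<union> {{a, b}}"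
  proof
    show "edges A \<union> edges B \<union> {{a, b}} \<subseteq> edges G"
      using ps(3) qs(3) edge unfolding A_def B_def arm_def by fastforce
    show "edges G \<subseteq> edges A \<union> edges B \<union> {{a, b}}"
    proof
      fix e assume e: "e \<in> edges G"
      then obtain x y where xy: "e = {x, y}"
        using simple by (metis card_2_iff simple_graph_def)
      have in_arm: "{u, v} \<in> edges A \<union> edges B"
        if uv: "{u, v} \<in> edges G" "u \<notin> {a, b}" for u v
      proof -
        have "u \<in> verts A \<union> verts B" using edge_in_verts(1)[OF simple uv(1)] verts by simp
        then consider p where "p \<in> set ps" "u \<in> set p" | q where "q \<in> set qs" "u \<in> set q"
          using uv(2) by (auto simp: A_def B_def)
        then show ?thesis
          using leaving(2)[OF ps(3) _ uv(1)] leaving(2)[OF qs(3) _ uv(1)]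
          by cases (auto simp: A_def B_def)
      qed
      show "e \<in> edges A \<union> edges B \<union> {{a, b}}"
      proof (cases "x \<in> {a, b} \<and> y \<in> {a, b}")
        case True
        then show ?thesis using e xy edge_in_verts(3)[OF simple, of x y] by auto
      next
        case False
        then show ?thesis
          using in_arm[of x y] in_arm[of y x] e unfolding xy by (auto simp: insert_commute)
      qed
    qed
  qed
  then show ?thesis
    unfolding DST_def using star disjoint verts degree_pos[OF a] degree_pos[OF b]
    by (intro CollectI conjI exI[of _ A] exI[of _ B] exI[of _ a] exI[of _ b]) auto
qed

end

section \<open>Degrees in a double starlike tree\<close>

text \<open>The heads of the \<open>k\<close> paths serve as \<open>N\<close>; they are distinct
  because the paths are nonempty and disjoint.\<close>

lemma starlike_tree_centre:
  assumes "starlike_tree S c k"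
  obtains N where "N \<subseteq> verts S" "card N = k" "c \<in> verts S" "\<And>v. v \<in> N \<Longrightarrow> {c, v} \<in> edges S"
proof -
  obtain ps where ps: "length ps = k" "\<forall>p\<in>set ps. p \<noteq> []" "distinct (c # concat ps)"
    "verts S = set (c # concat ps)" "edges S = (\<Union>p\<in>set ps. path_edges (c # p))"
    using assms by (auto simp: starlike_tree_def)
  have disj: "set p \<inter> set q = {}" if "p \<in> set ps" "q \<in> set ps" "p \<noteq> q" for p q
    using ps(3) that by (simp add: distinct_concat_iff)
  \<comment> \<open>\<open>distinct_concat_iff\<close> yields distinctness only after deleting empty
    members, of which there are none here.\<close>
  have "removeAll [] ps = ps" using ps(2) by (auto intro: removeAll_id)
  then have "distinct ps" using ps(3) by (simp add: distinct_concat_iff)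
  moreover have "inj_on hd (set ps)"
  proof (rule inj_onI, rule ccontr)
    fix p q assume "p \<in> set ps" "q \<in> set ps" "hd p = hd q" "p \<noteq> q"
    then show False using disj[of p q] ps(2) hd_in_set[of p] hd_in_set[of q] by auto
  qed
  ultimately have "card (hd ` set ps) = k"
    using ps(1) by (simp add: card_image distinct_card)
  moreover have "hd ` set ps \<subseteq> verts S" using ps(2,4) by auto
  moreover have "{c, v} \<in> edges S" if "v \<in> hd ` set ps" for v
    using that ps(2,5) by (auto simp: path_edges_Cons)
  ultimately show ?thesis using that[of "hd ` set ps"] ps(4) by simp
qed

lemma starlike_tree_edge_verts:
  assumes "starlike_tree S c k" "{x, y} \<in> edges S"
  shows "x \<in> verts S"
  using assms path_edges_in_set unfolding starlike_tree_def by fastforce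

text \<open>A vertex other than the centre lies on exactly one of the paths, where it has a
  predecessor and at most one successor.\<close>

lemma starlike_tree_neighbours:
  assumes "starlike_tree S c k" "x \<in> verts S" "x \<noteq> c"
  obtains r s where "{y. {x, y} \<in> edges S} \<subseteq> {r, s}"
proof -
  obtain ps where ps: "distinct (c # concat ps)"
    "verts S = set (c # concat ps)" "edges S = (\<Union>p\<in>set ps. path_edges (c # p))"
    using assms(1) by (auto simp: starlike_tree_def)
  obtain p where p: "p \<in> set ps" "x \<in> set p" using assms ps by auto
  have dist: "distinct (c # p)" using ps(1) p by (auto simp: distinct_concat_iff)
  obtain i where i: "i < length (c # p)" "x = (c # p) ! i"
    using p by (metis in_set_conv_nth list.set_intros(2))
  \<comment> \<open>For the last vertex of the path \<open>Suc i\<close> is out of range; the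
    arbitrary value only enlarges the set.\<close>
  have "y \<in> {(c # p) ! (i - 1), (c # p) ! Suc i}" if xy: "{x, y} \<in> edges S" for y
  proof -
    obtain q where q: "q \<in> set ps" "{x, y} \<in> path_edges (c # q)" using xy ps(3) by auto
    then have "x \<in> set q" using path_edges_in_set[OF q(2)] assms(3) by auto
    then have "q = p" using ps(1) p q(1) unfolding distinct.simps distinct_concat_iff by blast
    then show ?thesis using path_edges_neighbour[OF dist i(1)] q(2) i(2) by simp
  qed
  then show ?thesis using that by blast
qed

text \<open>A centre is adjacent to the heads of its paths and to the other centre; every other
  vertex has only its neighbours in its own starlike tree. Lower bounds for the centres suffice
  later, where the two largest degrees bound them from above.\<close>

lemma DST_degrees:
  assumes "simple_graph G" "G \<in> DST n p q"
  obtains u v where "{u, v} \<in> edges G" "p \<le> degree G u" "q \<le> degree G v"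
    "\<And>x. x \<in> verts G \<Longrightarrow> x \<noteq> u \<Longrightarrow> x \<noteq> v \<Longrightarrow> degree G x \<le> 2"
proof -
  obtain A B u v where pos: "0 < p" "0 < q" and star: "starlike_tree A u (p - 1)" "starlike_tree B v (q - 1)"
    and disj: "verts A \<inter> verts B = {}" and G: "verts G = verts A \<union> verts B"
      "edges G = edges A \<union> edges B \<union> {{u, v}}"
    using assms(2) unfolding DST_def by blast
  have fin: "finite (verts G)" using assms(1) by (simp add: simple_graph_def)
  have centre: "Suc k \<le> degree G c"
    if S: "starlike_tree S c k" and d: "d \<notin> verts S" "{c, d} \<in> edges G" "edges S \<subseteq> edges G"
      "verts S \<subseteq> verts G" for S c d k
  proof -
    obtain N where N: "N \<subseteq> verts S" "card N = k" "\<And>w. w \<in> N \<Longrightarrow> {c, w} \<in> edges S"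
      using starlike_tree_centre[OF S] by blast
    have "finite N" using finite_subset[OF subset_trans[OF N(1) d(4)] fin] .
    moreover have "d \<notin> N" using N(1) d(1) by blast
    ultimately have "Suc k = card (insert d N)" using N(2) by simp
    also have "\<dots> \<le> card {w. {c, w} \<in> edges G}"
      using N(3) d finite_neighbours[OF assms(1)] by (intro card_mono) auto
    finally show ?thesis by (simp add: degree_eq_neighbours[OF assms(1)])
  qed
  have other: "degree G x \<le> 2"
    if S: "starlike_tree S c k" "x \<in> verts S" "x \<noteq> c"
      and eq: "{y. {x, y} \<in> edges G} \<subseteq> {y. {x, y} \<in> edges S}" for S c k x
  proof -
    obtain r s where "{y. {x, y} \<in> edges S} \<subseteq> {r, s}"
      using starlike_tree_neighbours[OF S] by blast
    then have "card {y. {x, y} \<in> edges G} \<le> card {r, s}"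
      using eq by (intro card_mono) auto
    also have "\<dots> \<le> 2" by (simp add: card_insert_if)
    finally show ?thesis by (simp add: degree_eq_neighbours[OF assms(1)])
  qed
  have uv: "u \<in> verts A" "v \<in> verts B"
    using starlike_tree_centre[OF star(1)] starlike_tree_centre[OF star(2)] by blast+
  show ?thesis
  proof (rule that)
    show "{u, v} \<in> edges G" by (simp add: G)
    show "p \<le> degree G u"
      using centre[OF star(1), of v] disj uv G pos by auto
    show "q \<le> degree G v"
      using centre[OF star(2), of u] disj uv G pos by (auto simp: insert_commute)
    fix x assume x: "x \<in> verts G" "x \<noteq> u" "x \<noteq> v"
    show "degree G x \<le> 2"
    proof (cases "x \<in> verts A")
      case True
      then have "{x, y} \<notin> edges B" for y
        using starlike_tree_edge_verts[OF star(2)] disj by blast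
      then show ?thesis
        using x G by (intro other[OF star(1) True]) (auto simp: doubleton_eq_iff)
    next
      case False
      then have B: "x \<in> verts B" and "{x, y} \<notin> edges A" for y
        using starlike_tree_edge_verts[OF star(1)] x(1) G by blast+
      then show ?thesis
        using x G by (intro other[OF star(2) B]) (auto simp: doubleton_eq_iff)
    qed
  qed
qed

section \<open>Transfer to trees given by their two largest degrees\<close>

theorem theorem7p1:
  fixes T :: "'a graph" and n \<Delta> \<Delta>\<^sub>2 :: nat
  assumes "\<Delta> \<ge> 3"
    and "is_tree T"
    and "card (verts T) = n"
    and "max_degree T = \<Delta>"
    and "second_max_degree T = \<Delta>\<^sub>2"
  shows "SO1 T \<ge> 1 / 2 * ((real \<Delta> - 1) * ((real \<Delta>)\<^sup>2 - 1)
            + (real \<Delta>\<^sub>2 - 1) * ((real \<Delta>\<^sub>2)\<^sup>2 - 1) + (real \<Delta>)\<^sup>2 - (real \<Delta>\<^sub>2)\<^sup>2) \<and>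
         (SO1 T = 1 / 2 * ((real \<Delta> - 1) * ((real \<Delta>)\<^sup>2 - 1)
            + (real \<Delta>\<^sub>2 - 1) * ((real \<Delta>\<^sub>2)\<^sup>2 - 1) + (real \<Delta>)\<^sup>2 - (real \<Delta>\<^sub>2)\<^sup>2)
          \<longleftrightarrow> T \<in> DST n \<Delta> \<Delta>\<^sub>2)"
    (is "?B \<le> _ \<and> (_ \<longleftrightarrow> ?D)")
proof -
  have simple: "simple_graph T" and conn: "connected_graph T"
    using assms(2) by (auto simp: is_tree_def)
  have fin: "finite (verts T)" and ne: "verts T \<noteq> {}"
    using simple conn by (auto simp: simple_graph_def connected_graph_def)
  have "\<Delta> \<in> degree T ` verts T"
    unfolding assms(4)[symmetric] max_degree_def using fin ne by (intro Max_in) auto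
  then obtain w where "degree T w = \<Delta>" by auto
  \<comment> \<open>This ensures that index 1 of the degree sequence is in range.\<close>
  then have "\<Delta> \<le> card (verts T)"
    using card_mono[OF fin, of "{v \<in> verts T. {w, v} \<in> edges T}"] by (simp add: degree_def)
  then have "2 \<le> card (verts T)" using assms(1) by simp
  then obtain a b where ab: "a \<in> verts T" "b \<in> verts T" "a \<noteq> b" "degree T a = \<Delta>" "degree T b = \<Delta>\<^sub>2"
    "\<Delta>\<^sub>2 \<le> \<Delta>" "\<And>x. x \<in> verts T \<Longrightarrow> x \<noteq> a \<Longrightarrow> degree T x \<le> \<Delta>\<^sub>2"
    by (rule top_two_degrees[OF fin, unfolded assms(4,5)]) (rule that)
  interpret two_top T a b
    by unfold_locales (use assms ab in auto)
  have bound: "?B = 1 / 2 * (\<Sum>t\<in>{1<..degree T a}. (2 * real t - 1) * real (min_cut t))"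
    using sum_min_cut ab(4,5) by simp
  have "?D" if eq: "SO1 T = ?B"
  proof -
    obtain v where v: "{a, v} \<in> edges T" "degree T v = degree T b"
      "\<And>x. x \<in> verts T \<Longrightarrow> x \<noteq> a \<Longrightarrow> x \<noteq> v \<Longrightarrow> degree T x \<le> 2"
      using extremal_imp_adjacent eq unfolding bound SO1_eq_iff by blast
    \<comment> \<open>\<open>v\<close> replaces \<open>b\<close>: it has the same degree and is
      adjacent to \<open>a\<close>.\<close>
    interpret av: double_star T a v
      by unfold_locales (use assms ab v edge_in_verts[OF simple v(1)] in auto)
    show ?thesis using av.in_DST assms(3) ab v(2) by simp
  qed
  moreover have "SO1 T = ?B" if D: ?D
  proof -
    obtain u v where uv: "{u, v} \<in> edges T" "\<Delta> \<le> degree T u" "\<Delta>\<^sub>2 \<le> degree T v"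
      "\<And>x. x \<in> verts T \<Longrightarrow> x \<noteq> u \<Longrightarrow> x \<noteq> v \<Longrightarrow> degree T x \<le> 2"
      using DST_degrees[OF simple D] by blast
    note V = edge_in_verts[OF simple uv(1)]
    \<comment> \<open>A centre \<open>u\<close> other than \<open>a\<close> has degree at least
      \<open>\<Delta>\<close> but at most \<open>\<Delta>\<^sub>2\<close>, which forces a
      tie.\<close>
    have u: "u \<noteq> a \<Longrightarrow> \<Delta> = \<Delta>\<^sub>2" using ab(6) ab(7)[OF V(1)] uv(2) by simp
    have du: "degree T u = \<Delta>" using u uv(2) ab(4,6) ab(7)[OF V(1)] by (cases "u = a") auto
    have dv: "degree T v = \<Delta>\<^sub>2"
      using u uv(3) ab(4) ab(7)[OF V(2)] V(3) by (cases "v = a") auto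
    \<comment> \<open>The centres need not be \<open>a\<close> and \<open>b\<close>, but they have
      the same degrees, so the cut bounds apply to them with the same values.\<close>
    interpret uv: two_top T u v
    proof unfold_locales
      show "degree T x \<le> degree T v" if "x \<in> verts T" "x \<noteq> u" for x
        using that u ab(4,6) ab(7)[of x] dv by (cases "x = a") auto
    qed (use assms ab du dv V in auto)
    have "\<forall>t\<in>{1<..degree T u}. degree_cut T t = uv.min_cut t"
      using uv.adjacent_imp_extremal uv(1,4) by blast
    then show ?thesis
      using uv.SO1_eq_iff uv.sum_min_cut du dv by simp
  qed
  ultimately show ?thesis using SO1_ge unfolding bound by blast
qed

end
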